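(* Let $X$ and $Y$ be Hewitt spaces (i.e. realcompact Tychonoff spaces). Then the following are equivalent: (i) $X$ is homeomorphic to $Y$. (ii) The semirings $C_{+}(X)$ and $C_{+}(Y)$ are isomorphic. (iii) The graphs $\Gamma(C_{+}(X))$ and $\Gamma(C_{+}(Y))$ are isomorphic. (iv) The graphs $\Gamma(C(X))$ and $\Gamma(C(Y))$ are isomorphic. (v) The rings $C(X)$ and $C(Y)$ are isomorphic.
   Context: For a topological space $X$, $C(X)$ is the ring of real-valued continuous functions on $X$ and $C_{+}(X)$ is the semiring of non-negative real-valued continuous functions on $X$, both with pointwise addition and multiplication. For $f\in C(X)$, $Z(f)=\{x\in X: f(x)=0\}$. Let $\mathcal{N}(X)$ be the set of non-units of $C(X)$ (functions with $Z(f)\neq\emptyset$) and $\mathcal{N}'(X)=\mathcal{N}(X)\cap C_{+}(X)$, the set of non-units of $C_{+}(X)$. The zero-set intersection graph $\Gamma(C(X))$ has vertex set $\mathcal{N}(X)$, and $\Gamma(C_{+}(X))$ has vertex set $\mathcal{N}'(X)$; in each, distinct vertices $f,g$ are adjacent iff $Z(f)\cap Z(g)\neq\emptyset$. A graph isomorphism is a bijection between vertex sets such that two vertices are adjacent iff their images are adjacent. "Hewitt space" means realcompact Tychonoff space. *)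

theory Defs
  imports "HOL-Analysis.Analysis" "HOL-Algebra.QuotRing"
begin

text \<open>
  A space is an abstract topology \<open>X\<close>, so its points are \<open>topspace X\<close>. A function on \<open>X\<close> is
  represented by its extensional version (\<open>undefined\<close> outside \<open>topspace X\<close>), so that equality of
  elements of \<open>C_ring X\<close> is equality on \<open>X\<close>.
\<close>

definition C_ring :: "'a topology \<Rightarrow> ('a \<Rightarrow> real) ring" where
  "C_ring X =
    \<lparr>carrier = {f. continuous_map X euclideanreal f} \<inter> extensional (topspace X),
     mult = (\<lambda>f g. \<lambda>x\<in>topspace X. f x * g x),
     one = (\<lambda>x\<in>topspace X. 1),
     zero = (\<lambda>x\<in>topspace X. 0),
     add = (\<lambda>f g. \<lambda>x\<in>topspace X. f x + g x)\<rparr>"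

definition C_plus :: "'a topology \<Rightarrow> ('a \<Rightarrow> real) ring" where
  "C_plus X = (C_ring X)\<lparr>carrier := {f \<in> carrier (C_ring X). \<forall>x\<in>topspace X. 0 \<le> f x}\<rparr>"

definition zero_set :: "'a topology \<Rightarrow> ('a \<Rightarrow> real) \<Rightarrow> 'a set" where
  "zero_set X f = {x \<in> topspace X. f x = 0}"

definition real_ring :: "real ring" where
  "real_ring = \<lparr>carrier = UNIV, mult = (*), one = 1, zero = 0, add = (+)\<rparr>"

text \<open>
  Realcompactness in the sense of Hewitt and of Gillman and Jerison: every maximal ideal \<open>M\<close> of
  \<open>C(X)\<close> that is real (its residue field is the field of real numbers) is fixed (the zero sets of
  its members have a common point).
\<close>

definition realcompact_space :: "'a topology \<Rightarrow> bool" where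
  "realcompact_space X \<longleftrightarrow>
    (\<forall>M. maximalideal M (C_ring X) \<and> (C_ring X Quot M) \<simeq> real_ring \<longrightarrow>
         (\<Inter>f\<in>M. zero_set X f) \<noteq> {})"

definition Hewitt_space :: "'a topology \<Rightarrow> bool" where
  "Hewitt_space X \<longleftrightarrow>
    completely_regular_space X \<and> Hausdorff_space X \<and> realcompact_space X"

definition nonunits :: "'a topology \<Rightarrow> ('a \<Rightarrow> real) set" where
  "nonunits X = carrier (C_ring X) - Units (C_ring X)"

definition nonunits_plus :: "'a topology \<Rightarrow> ('a \<Rightarrow> real) set" where
  "nonunits_plus X = nonunits X \<inter> carrier (C_plus X)"

record 'v graph =
  verts :: "'v set"
  adjacent :: "'v \<Rightarrow> 'v \<Rightarrow> bool"

text \<open>Only the values of \<open>adjacent G\<close> on \<open>verts G\<close> are meaningful.\<close>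

definition graph_isomorphic :: "'v graph \<Rightarrow> 'w graph \<Rightarrow> bool" where
  "graph_isomorphic G H \<longleftrightarrow>
    (\<exists>\<phi>. bij_betw \<phi> (verts G) (verts H) \<and>
         (\<forall>u\<in>verts G. \<forall>v\<in>verts G. adjacent G u v \<longleftrightarrow> adjacent H (\<phi> u) (\<phi> v)))"

definition zero_set_adjacent :: "'a topology \<Rightarrow> ('a \<Rightarrow> real) \<Rightarrow> ('a \<Rightarrow> real) \<Rightarrow> bool" where
  "zero_set_adjacent X f g \<longleftrightarrow> f \<noteq> g \<and> zero_set X f \<inter> zero_set X g \<noteq> {}"

definition Gamma_C :: "'a topology \<Rightarrow> ('a \<Rightarrow> real) graph" where
  "Gamma_C X = \<lparr>verts = nonunits X, adjacent = zero_set_adjacent X\<rparr>"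

definition Gamma_C_plus :: "'a topology \<Rightarrow> ('a \<Rightarrow> real) graph" where
  "Gamma_C_plus X = \<lparr>verts = nonunits_plus X, adjacent = zero_set_adjacent X\<rparr>"

lemma mem_carrier_C_ring:
  "f \<in> carrier (C_ring X) \<longleftrightarrow>
    continuous_map X euclideanreal f \<and> f \<in> extensional (topspace X)"
  by (simp add: C_ring_def)

lemma mem_carrier_C_plus:
  "f \<in> carrier (C_plus X) \<longleftrightarrow>
    f \<in> carrier (C_ring X) \<and> (\<forall>x\<in>topspace X. 0 \<le> f x)"
  by (simp add: C_plus_def)

lemma restrict_in_carrier_C_ring:
  assumes "continuous_map X euclideanreal f"
  shows "restrict f (topspace X) \<in> carrier (C_ring X)"
  using continuous_map_eq[OF assms, of "restrict f (topspace X)"]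
  by (simp add: mem_carrier_C_ring)

lemma C_ring_simps:
  "f \<otimes>\<^bsub>C_ring X\<^esub> g = (\<lambda>x\<in>topspace X. f x * g x)"
  "f \<oplus>\<^bsub>C_ring X\<^esub> g = (\<lambda>x\<in>topspace X. f x + g x)"
  "\<one>\<^bsub>C_ring X\<^esub> = (\<lambda>x\<in>topspace X. 1)"
  "\<zero>\<^bsub>C_ring X\<^esub> = (\<lambda>x\<in>topspace X. 0)"
  by (simp_all add: C_ring_def)

lemma C_plus_simps:
  "f \<otimes>\<^bsub>C_plus X\<^esub> g = (\<lambda>x\<in>topspace X. f x * g x)"
  "f \<oplus>\<^bsub>C_plus X\<^esub> g = (\<lambda>x\<in>topspace X. f x + g x)"
  "\<one>\<^bsub>C_plus X\<^esub> = (\<lambda>x\<in>topspace X. 1)"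
  "\<zero>\<^bsub>C_plus X\<^esub> = (\<lambda>x\<in>topspace X. 0)"
  by (simp_all add: C_plus_def C_ring_def)

lemma C_ring_closed:
  assumes "f \<in> carrier (C_ring X)" "g \<in> carrier (C_ring X)"
  shows "(\<lambda>x\<in>topspace X. f x * g x) \<in> carrier (C_ring X)"
    and "(\<lambda>x\<in>topspace X. f x + g x) \<in> carrier (C_ring X)"
    and "(\<lambda>x\<in>topspace X. - f x) \<in> carrier (C_ring X)"
  using assms
  by (auto intro!: restrict_in_carrier_C_ring continuous_map_real_mult continuous_map_add
      continuous_map_minus simp: mem_carrier_C_ring)

lemma C_ring_const_closed: "(\<lambda>x\<in>topspace X. c) \<in> carrier (C_ring X)"
  by (rule restrict_in_carrier_C_ring) simp

lemma cring_C_ring: "cring (C_ring X)"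
proof (rule cringI)
  show "abelian_group (C_ring X)"
  proof (rule abelian_groupI)
    fix f assume f: "f \<in> carrier (C_ring X)"
    show "\<exists>g\<in>carrier (C_ring X). g \<oplus>\<^bsub>C_ring X\<^esub> f = \<zero>\<^bsub>C_ring X\<^esub>"
      by (rule bexI[OF _ C_ring_closed(3)[OF f f]]) (auto simp: C_ring_simps)
    show "\<zero>\<^bsub>C_ring X\<^esub> \<oplus>\<^bsub>C_ring X\<^esub> f = f"
      using f by (auto simp: C_ring_simps mem_carrier_C_ring fun_eq_iff extensional_def)
  qed (auto simp: C_ring_simps C_ring_closed C_ring_const_closed algebra_simps
        intro!: restrict_ext)
  show "Group.comm_monoid (C_ring X)"
  proof (rule comm_monoidI)
    fix f assume f: "f \<in> carrier (C_ring X)"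
    show "\<one>\<^bsub>C_ring X\<^esub> \<otimes>\<^bsub>C_ring X\<^esub> f = f"
      using f by (auto simp: C_ring_simps mem_carrier_C_ring fun_eq_iff extensional_def)
  qed (auto simp: C_ring_simps C_ring_closed C_ring_const_closed algebra_simps
        intro!: restrict_ext)
qed (auto simp: C_ring_simps algebra_simps intro!: restrict_ext)

lemma semiring_C_plus: "semiring (C_plus X)"
proof -
  have neutral: "(\<lambda>x\<in>topspace X. f x + \<zero>\<^bsub>C_plus X\<^esub> x) = f"
    "(\<lambda>x\<in>topspace X. \<zero>\<^bsub>C_plus X\<^esub> x + f x) = f"
    "(\<lambda>x\<in>topspace X. f x * \<one>\<^bsub>C_plus X\<^esub> x) = f"
    "(\<lambda>x\<in>topspace X. \<one>\<^bsub>C_plus X\<^esub> x * f x) = f"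
    if "f \<in> carrier (C_plus X)" for f
    using that
    by (auto simp: C_plus_simps mem_carrier_C_plus mem_carrier_C_ring fun_eq_iff extensional_def)
  have closed: "(\<lambda>x\<in>topspace X. f x + g x) \<in> carrier (C_plus X)"
    "(\<lambda>x\<in>topspace X. f x * g x) \<in> carrier (C_plus X)"
    if "f \<in> carrier (C_plus X)" "g \<in> carrier (C_plus X)" for f g
    using that by (auto simp: mem_carrier_C_plus C_ring_closed)
  have const_mem: "\<zero>\<^bsub>C_plus X\<^esub> \<in> carrier (C_plus X)" "\<one>\<^bsub>C_plus X\<^esub> \<in> carrier (C_plus X)"
    by (auto simp: mem_carrier_C_plus C_plus_simps C_ring_const_closed)
  have "Group.comm_monoid (add_monoid (C_plus X))"
    by (rule comm_monoidI)
      (auto simp: const_mem closed neutral C_plus_simps(1,2) algebra_simps intro!: restrict_ext)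
  moreover have "Group.monoid (C_plus X)"
    by (rule monoidI)
      (auto simp: const_mem closed neutral C_plus_simps(1,2) algebra_simps intro!: restrict_ext)
  ultimately show ?thesis
    by (auto simp: semiring_def semiring_axioms_def abelian_monoid_def C_plus_simps algebra_simps
        intro!: restrict_ext)
qed

lemma field_real_ring: "field real_ring"
proof -
  have cr: "cring real_ring"
  proof (rule cringI)
    show "abelian_group real_ring"
    proof (rule abelian_groupI)
      fix x show "\<exists>y\<in>carrier real_ring. y \<oplus>\<^bsub>real_ring\<^esub> x = \<zero>\<^bsub>real_ring\<^esub>"
        by (rule bexI[of _ "- x"]) (auto simp: real_ring_def)
    qed (auto simp: real_ring_def)
    show "Group.comm_monoid real_ring"
      by (rule comm_monoidI) (auto simp: real_ring_def)
  qed (auto simp: real_ring_def algebra_simps)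
  have "\<exists>y. y * x = 1 \<and> x * y = 1" if "x \<noteq> 0" for x :: real
    using that by (intro exI[of _ "inverse x"]) simp
  then have "Units real_ring = carrier real_ring - {\<zero>\<^bsub>real_ring\<^esub>}"
    unfolding Units_def by (auto simp: real_ring_def)
  then show ?thesis by (rule cring.cring_fieldI[OF cr])
qed

lemma inverse_in_carrier_C_ring:
  assumes f: "f \<in> carrier (C_ring X)" and "zero_set X f = {}"
  shows "(\<lambda>x\<in>topspace X. inverse (f x)) \<in> carrier (C_ring X)"
proof (rule restrict_in_carrier_C_ring)
  show "continuous_map X euclideanreal (\<lambda>x. inverse (f x))"
    using assms by (intro continuous_map_real_inverse) (auto simp: zero_set_def mem_carrier_C_ring)
qed

lemma mem_nonunits_iff:
  "f \<in> nonunits X \<longleftrightarrow> f \<in> carrier (C_ring X) \<and> zero_set X f \<noteq> {}"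
proof -
  have "f \<in> Units (C_ring X) \<longleftrightarrow> zero_set X f = {}" if f: "f \<in> carrier (C_ring X)"
  proof
    assume "f \<in> Units (C_ring X)"
    then obtain g where eq: "(\<lambda>x\<in>topspace X. g x * f x) = (\<lambda>x\<in>topspace X. 1)"
      by (auto simp: Units_def C_ring_simps)
    have "g x * f x = 1" if "x \<in> topspace X" for x
      using fun_cong[OF eq, of x] that by simp
    then have "f x \<noteq> 0" if "x \<in> topspace X" for x
      using that by (metis mult_zero_right zero_neq_one)
    then show "zero_set X f = {}" by (simp add: zero_set_def)
  next
    assume z: "zero_set X f = {}"
    let ?g = "\<lambda>x\<in>topspace X. inverse (f x)"
    have fg: "(\<lambda>x\<in>topspace X. f x * ?g x) = (\<lambda>x\<in>topspace X. 1)"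
      "(\<lambda>x\<in>topspace X. ?g x * f x) = (\<lambda>x\<in>topspace X. 1)"
      using z by (auto simp: zero_set_def intro!: restrict_ext)
    show "f \<in> Units (C_ring X)"
      unfolding Units_def C_ring_simps using f inverse_in_carrier_C_ring[OF f z] fg by blast
  qed
  then show ?thesis by (auto simp: nonunits_def)
qed

lemma nonunits_plus_eq: "nonunits_plus X = carrier (C_plus X) - Units (C_plus X)"
proof -
  have "f \<in> Units (C_plus X) \<longleftrightarrow> zero_set X f = {}" if f: "f \<in> carrier (C_plus X)" for f
  proof
    assume "f \<in> Units (C_plus X)"
    then obtain g where eq: "(\<lambda>x\<in>topspace X. g x * f x) = (\<lambda>x\<in>topspace X. 1)"
      by (auto simp: Units_def C_plus_simps)
    have "g x * f x = 1" if "x \<in> topspace X" for x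
      using fun_cong[OF eq, of x] that by simp
    then have "f x \<noteq> 0" if "x \<in> topspace X" for x
      using that by (metis mult_zero_right zero_neq_one)
    then show "zero_set X f = {}" by (simp add: zero_set_def)
  next
    assume z: "zero_set X f = {}"
    have f': "f \<in> carrier (C_ring X)" using f by (simp add: mem_carrier_C_plus)
    let ?g = "\<lambda>x\<in>topspace X. inverse (f x)"
    have fg: "(\<lambda>x\<in>topspace X. f x * ?g x) = (\<lambda>x\<in>topspace X. 1)"
      "(\<lambda>x\<in>topspace X. ?g x * f x) = (\<lambda>x\<in>topspace X. 1)"
      using z by (auto simp: zero_set_def intro!: restrict_ext)
    have "?g \<in> carrier (C_plus X)"
      using f inverse_in_carrier_C_ring[OF f' z] by (simp add: mem_carrier_C_plus)
    then show "f \<in> Units (C_plus X)"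
      unfolding Units_def C_plus_simps using f fg by blast
  qed
  then show ?thesis
    by (auto simp: nonunits_plus_def mem_nonunits_iff mem_carrier_C_plus)
qed

end

theory Submission
  imports Defs
begin

text \<open>
  A point of \<open>X\<close> is determined by the zero sets containing it. A graph isomorphism preserves which
  nonempty zero sets meet; by complete regularity it therefore preserves inclusions between them,
  hence also nonempty countable intersections, and it turns the zero sets containing a given point
  into a z-ultrafilter \<open>W\<close> on \<open>Y\<close> that is closed under countable intersections. Such a \<open>W\<close> defines a
  character of \<open>C(Y)\<close>, sending \<open>f\<close> to the unique \<open>r\<close> with \<open>{f = r} \<in> W\<close>; its kernel is a real maximal
  ideal, so realcompactness yields a point of \<open>Y\<close>. Conversely, the algebraic structure determines
  the graphs because \<open>Z(f) \<inter> Z(g)\<close> equals \<open>Z(f + g)\<close> on \<open>C\<^sub>+(X)\<close> and \<open>Z(f\<^sup>2 + g\<^sup>2)\<close> on \<open>C(X)\<close>.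
\<close>

section \<open>Zero sets\<close>

text \<open>All continuous maps are allowed here, not only the extensional ones in the ring:
  \<open>zero_set\<close> looks at values on the space alone, so the family is the same and no
  restriction has to be carried along.\<close>

definition zero_sets :: "'a topology \<Rightarrow> 'a set set" where
  "zero_sets X = zero_set X ` {f. continuous_map X euclideanreal f}"

lemma zero_setsI: "continuous_map X euclideanreal f \<Longrightarrow> zero_set X f \<in> zero_sets X"
  by (auto simp: zero_sets_def)

lemma zero_set_restrict [simp]: "zero_set X (restrict f (topspace X)) = zero_set X f"
  by (auto simp: zero_set_def)

lemma zero_sets_subset_topspace: "Z \<in> zero_sets X \<Longrightarrow> Z \<subseteq> topspace X"
  by (auto simp: zero_sets_def zero_set_def)

text \<open>A vertex enters the reconstruction only through its zero set. This and the analogue for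
  \<open>nonunits_plus\<close> show that both graphs carry the same family of sets, so one argument
  serves both.\<close>

lemma zero_set_nonunits: "zero_set X ` nonunits X = zero_sets X - {{}}"
proof -
  have "\<exists>g\<in>nonunits X. zero_set X g = zero_set X f"
    if "continuous_map X euclideanreal f" "zero_set X f \<noteq> {}" for f
    using that
    by (intro bexI[of _ "restrict f (topspace X)"])
      (auto simp: mem_nonunits_iff restrict_in_carrier_C_ring)
  then have "zero_sets X - {{}} \<subseteq> zero_set X ` nonunits X"
    unfolding zero_sets_def by blast
  moreover have "zero_set X ` nonunits X \<subseteq> zero_sets X - {{}}"
    by (auto simp: mem_nonunits_iff mem_carrier_C_ring intro: zero_setsI)
  ultimately show ?thesis by blast
qed

text \<open>Replacing f by its absolute value keeps the zero set and makes the function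
  non-negative.\<close>

lemma zero_set_nonunits_plus: "zero_set X ` nonunits_plus X = zero_sets X - {{}}"
proof -
  have "\<exists>g\<in>nonunits_plus X. zero_set X g = zero_set X f" if "f \<in> nonunits X" for f
  proof (intro bexI)
    show eq: "zero_set X (\<lambda>x\<in>topspace X. \<bar>f x\<bar>) = zero_set X f"
      by (auto simp: zero_set_def)
    show "(\<lambda>x\<in>topspace X. \<bar>f x\<bar>) \<in> nonunits_plus X"
      using that unfolding nonunits_plus_def Int_iff mem_nonunits_iff mem_carrier_C_plus eq
      by (auto simp: mem_carrier_C_ring intro!: restrict_in_carrier_C_ring[unfolded mem_carrier_C_ring]
          continuous_map_real_abs)
  qed
  then have "zero_set X ` nonunits X \<subseteq> zero_set X ` nonunits_plus X"
    by (metis image_subsetI imageI)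
  moreover have "nonunits_plus X \<subseteq> nonunits X" by (simp add: nonunits_plus_def)
  ultimately have "zero_set X ` nonunits_plus X = zero_set X ` nonunits X" by blast
  then show ?thesis by (simp add: zero_set_nonunits)
qed

section \<open>Closedness, level sets and countable intersections of zero sets\<close>

lemma closedin_zero_sets: "Z \<in> zero_sets X \<Longrightarrow> closedin X Z"
  using closedin_continuous_map_preimage[of X euclideanreal _ "{0}"]
  by (auto simp: zero_sets_def zero_set_def)

lemma zero_sets_le:
  assumes "continuous_map X euclideanreal f"
  shows "{x \<in> topspace X. f x \<le> a} \<in> zero_sets X"
proof -
  have "{x \<in> topspace X. f x \<le> a} = zero_set X (\<lambda>x. max (f x - a) 0)"
    by (auto simp: zero_set_def max_def)
  then show ?thesis
    by (auto intro!: zero_setsI continuous_map_real_max continuous_map_diff assms)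
qed

lemma zero_sets_ge:
  assumes "continuous_map X euclideanreal f"
  shows "{x \<in> topspace X. a \<le> f x} \<in> zero_sets X"
  using zero_sets_le[OF continuous_map_minus[OF assms], of "- a"] by simp

lemma zero_sets_eq:
  assumes "continuous_map X euclideanreal f"
  shows "{x \<in> topspace X. f x = a} \<in> zero_sets X"
proof -
  have "{x \<in> topspace X. f x = a} = zero_set X (\<lambda>x. f x - a)"
    by (auto simp: zero_set_def)
  then show ?thesis
    by (auto intro!: zero_setsI continuous_map_diff assms)
qed

lemma zero_sets_Inter:
  fixes A :: "nat \<Rightarrow> 'a set"
  assumes "\<And>n. A n \<in> zero_sets X"
  shows "(\<Inter>n. A n) \<in> zero_sets X"
proof -
  have "\<forall>n. \<exists>f. continuous_map X euclideanreal f \<and> A n = zero_set X f"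
    using assms unfolding zero_sets_def by blast
  then obtain f where f: "\<And>n. continuous_map X euclideanreal (f n)"
    and A: "\<And>n. A n = zero_set X (f n)"
    by metis
  \<comment> \<open>Truncating at 1 and weighting by a geometric factor dominates the series
    uniformly, so its sum is continuous; since all terms are non-negative, it vanishes exactly where
    every \<open>f n\<close> does.\<close>
  define t where "t n x = min \<bar>f n x\<bar> 1 * (1/2) ^ n" for n x
  define g where "g x = (\<Sum>n. t n x)" for x
  have bound: "norm (t n x) \<le> (1/2) ^ n" and nonneg: "0 \<le> t n x" for n x
    by (auto simp: t_def abs_mult mult_le_cancel_right1)
  have half: "summable (\<lambda>n. (1/2::real) ^ n)" by (simp add: summable_geometric)
  have summable: "summable (\<lambda>n. t n x)" for x
    by (rule summable_comparison_test'[OF half, of 0]) (rule bound)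
  have unif: "uniform_limit (topspace X) (\<lambda>n x. \<Sum>i<n. t i x) g sequentially"
    unfolding g_def by (rule Weierstrass_m_test[OF bound half])
  have "continuous_map X euclideanreal g"
    unfolding mtopology_is_euclidean[symmetric]
  proof (rule Met_TC.continuous_map_uniform_limit[OF always_eventually])
    show "\<forall>n. continuous_map X Met_TC.mtopology (\<lambda>x. \<Sum>i<n. t i x)"
      unfolding mtopology_is_euclidean t_def
      by (intro allI continuous_map_sum continuous_map_real_mult_right continuous_map_real_min
          continuous_map_real_abs f) auto
    show "\<forall>\<^sub>F n in sequentially. \<forall>x\<in>topspace X. g x \<in> UNIV \<and> dist (\<Sum>i<n. t i x) (g x) < e"
      if "0 < e" for e
      using uniform_limitD[OF unif that] by simp
  qed simp
  moreover have "g x = 0 \<longleftrightarrow> (\<forall>n. f n x = 0)" for x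
  proof -
    have "g x = 0 \<longleftrightarrow> (\<forall>n. t n x = 0)"
      unfolding g_def by (rule suminf_eq_zero_iff[OF summable nonneg])
    also have "\<dots> \<longleftrightarrow> (\<forall>n. f n x = 0)" by (auto simp: t_def min_def)
    finally show ?thesis .
  qed
  then have "(\<Inter>n. A n) = zero_set X g" by (auto simp: A zero_set_def)
  ultimately show ?thesis by (simp add: zero_setsI)
qed

text \<open>The separating function vanishes at x and is 1 on C, so its own zero set works. This
  form detects non-membership of a point by a zero set that is disjoint from C.\<close>

lemma completely_regular_separation:
  assumes "completely_regular_space X" "closedin X C" "x \<in> topspace X" "x \<notin> C"
  shows "\<exists>Z\<in>zero_sets X. x \<in> Z \<and> Z \<inter> C = {}"
proof -
  obtain f where f: "continuous_map X euclideanreal f" "f x = 0" "f ` C \<subseteq> {1}"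
    using assms unfolding completely_regular_space_alt by blast
  have "x \<in> zero_set X f" "zero_set X f \<inter> C = {}"
    using f assms(3) by (auto simp: zero_set_def)
  then show ?thesis using zero_setsI[OF f(1)] by blast
qed

text \<open>Here the level set at 1 of the same function is taken: every closed set is an
  intersection of zero sets, which is what continuity will need.\<close>

lemma completely_regular_separation':
  assumes "completely_regular_space X" "closedin X C" "x \<in> topspace X" "x \<notin> C"
  shows "\<exists>Z\<in>zero_sets X. C \<subseteq> Z \<and> x \<notin> Z"
proof -
  obtain f where f: "continuous_map X euclideanreal f" "f x = 0" "f ` C \<subseteq> {1}"
    using assms unfolding completely_regular_space_alt by blast
  have "C \<subseteq> {x \<in> topspace X. f x = 1}"
    using f(3) closedin_subset[OF assms(2)] by auto
  moreover have "x \<notin> {x \<in> topspace X. f x = 1}" using f(2) by simp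
  ultimately show ?thesis using zero_sets_eq[OF f(1)] by blast
qed

section \<open>Real z-ultrafilters\<close>

text \<open>The condition \<open>mem_iff\<close> packs the intersection property and maximality into
  one equivalence. Countable closure asks only for a lower bound in \<open>W\<close>; upward closure
  then supplies the intersection-type statements.\<close>

locale real_z_ultrafilter =
  fixes X :: "'a topology" and W :: "'a set set"
  assumes sub: "W \<subseteq> zero_sets X"
    and mem_iff: "Z \<in> zero_sets X \<Longrightarrow> Z \<in> W \<longleftrightarrow> (\<forall>A\<in>W. Z \<inter> A \<noteq> {})"
    and countable: "(\<And>n::nat. A n \<in> W) \<Longrightarrow> \<exists>Z\<in>W. \<forall>n. Z \<subseteq> A n"
begin

lemma meets: "A \<in> W \<Longrightarrow> B \<in> W \<Longrightarrow> A \<inter> B \<noteq> {}"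
  using mem_iff[of A] sub by auto

lemma nonempty: "Z \<in> W \<Longrightarrow> Z \<noteq> {}"
  using meets[of Z Z] by simp

lemma upward:
  assumes "A \<in> W" "A \<subseteq> Z" "Z \<in> zero_sets X"
  shows "Z \<in> W"
  unfolding mem_iff[OF assms(3)] using assms(1,2) meets by blast

lemma intersection:
  assumes "A \<in> W" "B \<in> W"
  shows "\<exists>C\<in>W. C \<subseteq> A \<and> C \<subseteq> B"
proof -
  \<comment> \<open>The sequence A, B, B, ... reduces binary intersections to the countable
    axiom.\<close>
  have "\<exists>Z\<in>W. \<forall>n::nat. Z \<subseteq> (if n = 0 then A else B)"
    using assms by (intro countable) auto
  then show ?thesis by (metis one_neq_zero)
qed

text \<open>If both sets were outside \<open>W\<close>, each would miss some member; a common lower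
  bound of these two members would then miss the whole space and be empty.\<close>

lemma prime:
  assumes "Z \<in> zero_sets X" "Z' \<in> zero_sets X" "topspace X \<subseteq> Z \<union> Z'"
  shows "Z \<in> W \<or> Z' \<in> W"
proof (rule ccontr)
  assume "\<not> ?thesis"
  then obtain A B where A: "A \<in> W" "Z \<inter> A = {}" and B: "B \<in> W" "Z' \<inter> B = {}"
    using mem_iff[OF assms(1)] mem_iff[OF assms(2)] by auto
  obtain C where C: "C \<in> W" "C \<subseteq> A" "C \<subseteq> B"
    using intersection[OF A(1) B(1)] by blast
  have "C \<subseteq> topspace X" using C(1) sub by (intro zero_sets_subset_topspace) auto
  then have "C = {}" using assms(3) A(2) B(2) C(2,3) by blast
  then show False using nonempty[OF C(1)] by blast
qed

text \<open>The numbers q with {f \<ge> q} in \<open>W\<close> form a lower cut, whose supremum is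
  the value. Countable closure is used three times: to bound the cut above, to make it nonempty, and
  to squeeze f to the supremum itself on a single member.\<close>

lemma exists_value:
  assumes f: "continuous_map X euclideanreal f"
  shows "\<exists>r. {x \<in> topspace X. f x = r} \<in> W"
proof -
  define S where "S = {q. {x \<in> topspace X. q \<le> f x} \<in> W}"
  have down: "p \<in> S" if "q \<in> S" "p \<le> q" for p q
    using that zero_sets_ge[OF f, of p] unfolding S_def
    by (auto elim!: upward)
  have le: "{x \<in> topspace X. f x \<le> q} \<in> W" if "q \<notin> S" for q
  proof -
    have "topspace X \<subseteq> {x \<in> topspace X. f x \<le> q} \<union> {x \<in> topspace X. q \<le> f x}" by auto
    then show ?thesis
      using prime[OF zero_sets_le[OF f] zero_sets_ge[OF f]] that unfolding S_def by blast
  qed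
  \<comment> \<open>Otherwise some nonempty member of \<open>W\<close> would lie in all the sets {f
    \<ge> n}, against the Archimedean property.\<close>
  have "\<exists>n::nat. real n \<notin> S"
  proof (rule ccontr)
    assume "\<not> ?thesis"
    then have "\<exists>Z\<in>W. \<forall>n. Z \<subseteq> {x \<in> topspace X. real n \<le> f x}"
      by (intro countable) (simp add: S_def)
    then obtain Z where Z: "Z \<in> W" "\<And>n. Z \<subseteq> {x \<in> topspace X. real n \<le> f x}" by blast
    then obtain x where "x \<in> Z" using nonempty[OF Z(1)] by blast
    then have "real n \<le> f x" for n using Z(2)[of n] by blast
    then show False by (metis reals_Archimedean2 not_less)
  qed
  then obtain u where "real u \<notin> S" ..
  then have bdd: "bdd_above S" using down by (meson bdd_aboveI linear)
  have "\<exists>n::nat. - real n \<in> S"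
  proof (rule ccontr)
    assume "\<not> ?thesis"
    then have "\<exists>Z\<in>W. \<forall>n::nat. Z \<subseteq> {x \<in> topspace X. f x \<le> - real n}"
      by (intro countable le) simp
    then obtain Z where Z: "Z \<in> W" "\<And>n. Z \<subseteq> {x \<in> topspace X. f x \<le> - real n}" by blast
    then obtain x where "x \<in> Z" using nonempty[OF Z(1)] by blast
    then have "real n \<le> - f x" for n using Z(2)[of n] by fastforce
    then show False by (metis reals_Archimedean2 not_less)
  qed
  then have ne: "S \<noteq> {}" by blast
  define r where "r = Sup S"
  define e where "e n = inverse (real (Suc n))" for n
  have e: "0 < e n" for n by (simp add: e_def)
  have "r - e n \<in> S" for n
  proof -
    have "r - e n < Sup S" using e[of n] by (simp add: r_def)
    then obtain q where "q \<in> S" "r - e n < q" using less_cSupD[OF ne] by blast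
    then show ?thesis using down by fastforce
  qed
  then have ge_r: "{x \<in> topspace X. r - e n \<le> f x} \<in> W" for n by (simp add: S_def)
  have "r + e n \<notin> S" for n
    using cSup_upper[OF _ bdd, of "r + e n"] e[of n] by (auto simp: r_def)
  then have le_r: "{x \<in> topspace X. f x \<le> r + e n} \<in> W" for n by (rule le)
  obtain A where A: "A \<in> W" "\<And>n. A \<subseteq> {x \<in> topspace X. r - e n \<le> f x}"
    using countable[where A = "\<lambda>n. {x \<in> topspace X. r - e n \<le> f x}", OF ge_r] by blast
  obtain B where B: "B \<in> W" "\<And>n. B \<subseteq> {x \<in> topspace X. f x \<le> r + e n}"
    using countable[where A = "\<lambda>n. {x \<in> topspace X. f x \<le> r + e n}", OF le_r] by blast
  obtain C where C: "C \<in> W" "C \<subseteq> A" "C \<subseteq> B" using intersection[OF A(1) B(1)] by blast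
  have "C \<subseteq> {x \<in> topspace X. f x = r}"
  proof
    fix x assume "x \<in> C"
    then have x: "x \<in> topspace X" "r - e n \<le> f x" "f x \<le> r + e n" for n
      using C A(2)[of n] B(2)[of n] by auto
    have "\<bar>f x - r\<bar> \<le> 0"
    proof (rule ccontr)
      assume "\<not> ?thesis"
      then obtain n where "e n < \<bar>f x - r\<bar>"
        unfolding e_def using reals_Archimedean[of "\<bar>f x - r\<bar>"] by auto
      then show False using x(2,3)[of n] by linarith
    qed
    then show "x \<in> {x \<in> topspace X. f x = r}" using x(1) by simp
  qed
  then show ?thesis using upward[OF C(1)] zero_sets_eq[OF f] by blast
qed

section \<open>The character defined by a real z-ultrafilter\<close>

definition val :: "('a \<Rightarrow> real) \<Rightarrow> real" where
  "val f = (THE r. {x \<in> topspace X. f x = r} \<in> W)"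

lemma val_eqI: "{x \<in> topspace X. f x = r} \<in> W \<Longrightarrow> val f = r"
  unfolding val_def
proof (rule the_equality)
  fix s assume "{x \<in> topspace X. f x = r} \<in> W" "{x \<in> topspace X. f x = s} \<in> W"
  then have "{x \<in> topspace X. f x = s} \<inter> {x \<in> topspace X. f x = r} \<noteq> {}"
    by (intro meets)
  then show "s = r" by blast
qed

lemma val_level:
  assumes "continuous_map X euclideanreal f"
  shows "{x \<in> topspace X. f x = val f} \<in> W"
  using exists_value[OF assms] val_eqI by metis

text \<open>On a common member of \<open>W\<close> both f and g are constant, hence so is h. Leaving
  \<open>op\<close> arbitrary treats sums and products at once.\<close>

lemma val_binop:
  assumes f: "continuous_map X euclideanreal f" and g: "continuous_map X euclideanreal g"
    and h: "continuous_map X euclideanreal h"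
    and eq: "\<And>x. x \<in> topspace X \<Longrightarrow> h x = op (f x) (g x)"
  shows "val h = op (val f) (val g)"
proof -
  obtain C where C: "C \<in> W" "C \<subseteq> {x \<in> topspace X. f x = val f}"
    "C \<subseteq> {x \<in> topspace X. g x = val g}"
    using intersection[OF val_level[OF f] val_level[OF g]] by blast
  have "C \<subseteq> {x \<in> topspace X. h x = op (val f) (val g)}"
  proof
    fix x assume "x \<in> C"
    then have "x \<in> topspace X" "f x = val f" "g x = val g" using C(2,3) by auto
    then show "x \<in> {x \<in> topspace X. h x = op (val f) (val g)}" by (simp add: eq)
  qed
  then show ?thesis by (intro val_eqI upward[OF C(1)] zero_sets_eq[OF h])
qed

lemma val_const: "val (\<lambda>x\<in>topspace X. c) = c"
proof -
  have "{x \<in> topspace X. (\<lambda>x\<in>topspace X. c) x = val (\<lambda>x\<in>topspace X. c)} \<noteq> {}"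
    using C_ring_const_closed[of c X] unfolding mem_carrier_C_ring
    by (intro nonempty val_level) blast
  then show ?thesis by auto
qed

lemma ring_hom_val: "ring_hom_ring (C_ring X) real_ring val"
proof (rule ring_hom_ringI)
  fix f g assume fg: "f \<in> carrier (C_ring X)" "g \<in> carrier (C_ring X)"
  note c = fg[THEN mem_carrier_C_ring[THEN iffD1], THEN conjunct1]
    C_ring_closed(1,2)[OF fg, THEN mem_carrier_C_ring[THEN iffD1], THEN conjunct1]
  show "val (f \<otimes>\<^bsub>C_ring X\<^esub> g) = val f \<otimes>\<^bsub>real_ring\<^esub> val g"
    unfolding C_ring_simps using val_binop[OF c(1,2,3), of "(*)"] by (simp add: real_ring_def)
  show "val (f \<oplus>\<^bsub>C_ring X\<^esub> g) = val f \<oplus>\<^bsub>real_ring\<^esub> val g"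
    unfolding C_ring_simps using val_binop[OF c(1,2,4), of "(+)"] by (simp add: real_ring_def)
qed (use cring_C_ring field_real_ring in
    \<open>auto simp: real_ring_def C_ring_simps val_const cring_def field_def domain_def\<close>)

text \<open>The kernel of \<open>val\<close> is a maximal ideal with residue field the reals,
  constants making \<open>val\<close> onto. A common zero of the kernel lies in every member of
  \<open>W\<close>, because a function whose zero set is in \<open>W\<close> has value 0.\<close>

lemma fixed:
  assumes "realcompact_space X"
  shows "\<exists>x\<in>topspace X. \<forall>Z\<in>W. x \<in> Z"
proof -
  interpret C: cring "C_ring X" by (rule cring_C_ring)
  interpret h: ring_hom_ring "C_ring X" real_ring val by (rule ring_hom_val)
  let ?M = "a_kernel (C_ring X) real_ring val"
  have M: "?M = {f \<in> carrier (C_ring X). val f = 0}"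
    unfolding a_kernel_def' by (simp add: real_ring_def)
  have surj: "val ` carrier (C_ring X) = carrier real_ring"
  proof -
    have "r \<in> val ` carrier (C_ring X)" for r
      using imageI[OF C_ring_const_closed[of r X], of val] by (simp only: val_const)
    then show ?thesis by (auto simp: real_ring_def)
  qed
  have "maximalideal ?M (C_ring X)"
  proof (rule maximalidealI[OF h.kernel_is_ideal])
    have "\<one>\<^bsub>C_ring X\<^esub> \<notin> ?M" by (simp add: M C_ring_simps val_const)
    then show "carrier (C_ring X) \<noteq> ?M" using C.one_closed by blast
  next
    fix J assume J: "ideal J (C_ring X)" "?M \<subseteq> J" "J \<subseteq> carrier (C_ring X)"
    interpret J: ideal J "C_ring X" by fact
    show "J = ?M \<or> J = carrier (C_ring X)"
    proof (rule disjCI)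
      assume "J \<noteq> carrier (C_ring X)"
      then have one: "\<one>\<^bsub>C_ring X\<^esub> \<notin> J" using J.one_imp_carrier by blast
      \<comment> \<open>If an element of J had nonzero value, dividing it by that value would give p
        in J with value 1; then 1 - p is in the kernel, hence in J, and J would contain 1.\<close>
      have "val f = 0" if f: "f \<in> J" for f
      proof (rule ccontr)
        assume nz: "val f \<noteq> 0"
        define k where "k = (\<lambda>x\<in>topspace X. inverse (val f))"
        have k: "k \<in> carrier (C_ring X)" unfolding k_def by (rule C_ring_const_closed)
        have fc: "f \<in> carrier (C_ring X)" using J(3) f by blast
        let ?p = "f \<otimes>\<^bsub>C_ring X\<^esub> k"
        have pJ: "?p \<in> J" by (rule J.I_r_closed[OF f k])
        have pc: "?p \<in> carrier (C_ring X)" using J(3) pJ by blast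
        have val_p: "val ?p = 1"
          using nz h.hom_mult[OF fc k] val_const[of "inverse (val f)"]
          by (simp add: real_ring_def k_def)
        let ?d = "\<one>\<^bsub>C_ring X\<^esub> \<ominus>\<^bsub>C_ring X\<^esub> ?p"
        have dc: "?d \<in> carrier (C_ring X)" using pc by simp
        have sum: "?d \<oplus>\<^bsub>C_ring X\<^esub> ?p = \<one>\<^bsub>C_ring X\<^esub>"
          using pc by (simp add: C.minus_eq C.a_assoc C.l_neg)
        then have "val ?d = 0"
          using h.hom_add[OF dc pc] val_p h.hom_one by (simp add: real_ring_def)
        then have "?d \<in> J" using dc J(2) M by blast
        then show False using J.a_closed[OF _ pJ] sum one by metis
      qed
      then show "J = ?M" using J(2,3) M by blast
    qed
  qed
  then have "(\<Inter>f\<in>?M. zero_set X f) \<noteq> {}"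
    using assms h.FactRing_iso[OF surj] unfolding realcompact_space_def by blast
  then obtain x where x: "\<And>f. f \<in> ?M \<Longrightarrow> x \<in> zero_set X f" by blast
  \<comment> \<open>The zero set of the zero function is the whole space, which places x in
    it.\<close>
  have "\<zero>\<^bsub>C_ring X\<^esub> \<in> ?M" by (simp add: M C_ring_simps val_const C_ring_const_closed)
  then have "x \<in> topspace X" using x unfolding zero_set_def by blast
  moreover have "x \<in> Z" if Z: "Z \<in> W" for Z
  proof -
    obtain f where f: "continuous_map X euclideanreal f" "Z = zero_set X f"
      using Z sub unfolding zero_sets_def by blast
    have "zero_set X (restrict f (topspace X)) \<in> W" using f Z by simp
    then have "val (restrict f (topspace X)) = 0"
      unfolding zero_set_def by (rule val_eqI)
    then have "restrict f (topspace X) \<in> ?M"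
      by (simp add: M restrict_in_carrier_C_ring f(1))
    then show ?thesis using x f(2) by force
  qed
  ultimately show ?thesis by blast
qed

end

section \<open>Reconstructing the space\<close>

text \<open>
  A graph isomorphism \<open>\<phi>\<close> gives the matching with \<open>F f = Z(f)\<close> and \<open>G f = Z(\<phi> f)\<close>; in this form the
  roles of \<open>X\<close> and \<open>Y\<close> can be interchanged.
\<close>

locale zero_set_matching =
  fixes X :: "'a topology" and Y :: "'b topology"
    and I :: "'i set" and F :: "'i \<Rightarrow> 'a set" and G :: "'i \<Rightarrow> 'b set"
  assumes X: "Hewitt_space X" and Y: "Hewitt_space Y"
    and F: "F ` I = zero_sets X - {{}}" and G: "G ` I = zero_sets Y - {{}}"
    and meet: "i \<in> I \<Longrightarrow> j \<in> I \<Longrightarrow> F i \<inter> F j \<noteq> {} \<longleftrightarrow> G i \<inter> G j \<noteq> {}"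
begin

section \<open>The correspondence between points\<close>

definition related :: "'a \<Rightarrow> 'b \<Rightarrow> bool" where
  "related x y \<longleftrightarrow> x \<in> topspace X \<and> y \<in> topspace Y \<and> (\<forall>i\<in>I. x \<in> F i \<longleftrightarrow> y \<in> G i)"

lemma F_zero_sets: "i \<in> I \<Longrightarrow> F i \<in> zero_sets X"
  and G_zero_sets: "i \<in> I \<Longrightarrow> G i \<in> zero_sets Y"
  using F G by auto

lemma F_cover: "Z \<in> zero_sets X \<Longrightarrow> x \<in> Z \<Longrightarrow> \<exists>i\<in>I. F i = Z"
proof -
  assume "Z \<in> zero_sets X" "x \<in> Z"
  then have "Z \<in> F ` I" by (auto simp: F)
  then show ?thesis by blast
qed

lemma G_cover: "Z \<in> zero_sets Y \<Longrightarrow> y \<in> Z \<Longrightarrow> \<exists>i\<in>I. G i = Z"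
proof -
  assume "Z \<in> zero_sets Y" "y \<in> Z"
  then have "Z \<in> G ` I" by (auto simp: G)
  then show ?thesis by blast
qed

text \<open>A point outside \<open>F i\<close> has a zero set around it that misses
  \<open>F i\<close>. So membership in \<open>F i\<close> can be read off from which indexed sets
  meet, the only information that a matching transports.\<close>

lemma mem_F:
  assumes "i \<in> I" "x \<in> topspace X" "\<And>j. j \<in> I \<Longrightarrow> x \<in> F j \<Longrightarrow> F i \<inter> F j \<noteq> {}"
  shows "x \<in> F i"
proof (rule ccontr)
  assume "x \<notin> F i"
  moreover have "closedin X (F i)"
    using closedin_zero_sets[OF F_zero_sets[OF assms(1)]] .
  ultimately obtain Z where Z: "Z \<in> zero_sets X" "x \<in> Z" "Z \<inter> F i = {}"
    using X assms(2) completely_regular_separation[of X "F i" x] unfolding Hewitt_space_def by blast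
  then obtain j where "j \<in> I" "F j = Z" using F_cover[OF Z(1,2)] by blast
  then show False using assms(3)[of j] Z by blast
qed

text \<open>Inclusion is transported in this weak form first: every indexed set meeting
  \<open>G i\<close> meets \<open>G j\<close>. Complete regularity of Y later turns it into a true
  inclusion.\<close>

lemma G_mono:
  assumes "i \<in> I" "j \<in> I" "F i \<subseteq> F j" "k \<in> I" "G k \<inter> G i \<noteq> {}"
  shows "G k \<inter> G j \<noteq> {}"
  using assms(3,5) meet[OF assms(4,1)] meet[OF assms(4,2)] by blast

text \<open>The sets \<open>G i\<close> whose partners \<open>F i\<close> contain x form a real
  z-ultrafilter on Y. Realcompactness of Y gives a point y in all of them, and maximality shows that
  y lies in no other \<open>G i\<close>.\<close>

lemma related_exists:
  assumes x: "x \<in> topspace X"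
  shows "\<exists>y. related x y"
proof -
  define U where "U = {i \<in> I. x \<in> F i}"
  have in_U: "i \<in> U" if "i \<in> I" "\<And>j. j \<in> U \<Longrightarrow> G i \<inter> G j \<noteq> {}" for i
    using mem_F[OF that(1) x] that meet by (auto simp: U_def)
  have U_meet: "G i \<inter> G j \<noteq> {}" if "i \<in> U" "j \<in> U" for i j
    using that meet by (auto simp: U_def)
  have top: "topspace X \<in> zero_sets X"
    using zero_setsI[of X "\<lambda>_. 0"] by (simp add: zero_set_def)
  have "U \<noteq> {}" using F_cover[OF top x] x by (auto simp: U_def)
  interpret real_z_ultrafilter Y "G ` U"
  proof
    show "G ` U \<subseteq> zero_sets Y" by (auto simp: U_def G_zero_sets)
  next
    fix Z assume Z: "Z \<in> zero_sets Y"
    show "Z \<in> G ` U \<longleftrightarrow> (\<forall>A\<in>G ` U. Z \<inter> A \<noteq> {})"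
    proof
      assume *: "\<forall>A\<in>G ` U. Z \<inter> A \<noteq> {}"
      \<comment> \<open>Only nonempty zero sets have an index; Z is nonempty because there is at
        least one set that it meets.\<close>
      then have "Z \<noteq> {}" using \<open>U \<noteq> {}\<close> by blast
      then obtain z where "z \<in> Z" by blast
      then obtain i where i: "i \<in> I" "Z = G i" using G_cover[OF Z] by blast
      then have "i \<in> U" using in_U[OF i(1)] * by simp
      then show "Z \<in> G ` U" using i(2) by simp
    qed (use U_meet in auto)
  next
    fix A :: "nat \<Rightarrow> 'b set" assume "\<And>n. A n \<in> G ` U"
    then have "\<forall>n. \<exists>j. j \<in> U \<and> A n = G j" by (simp add: image_iff Bex_def)
    then obtain i where i: "\<And>n. i n \<in> U" "\<And>n. A n = G (i n)" by metis
    \<comment> \<open>The intersection is formed on the side of X, where x keeps it nonempty and so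
      gives it an index k; \<open>G k\<close> is the required lower bound in Y.\<close>
    have "(\<Inter>n. F (i n)) \<in> zero_sets X"
      using i(1) by (intro zero_sets_Inter F_zero_sets) (simp add: U_def)
    moreover have "x \<in> (\<Inter>n. F (i n))" using i(1) by (auto simp: U_def)
    ultimately obtain k where k: "k \<in> I" "F k = (\<Inter>n. F (i n))"
      using F_cover[of "\<Inter>n. F (i n)" x] by blast
    then have "k \<in> U" using i(1) by (auto simp: U_def)
    moreover have "G k \<subseteq> A n" for n
    proof
      fix y assume y: "y \<in> G k"
      have ytop: "y \<in> topspace Y" using y zero_sets_subset_topspace[OF G_zero_sets[OF k(1)]] by blast
      show "y \<in> A n"
      proof (rule ccontr)
        assume "y \<notin> A n"
        moreover have "i n \<in> I" using i(1) by (auto simp: U_def)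
        moreover have "closedin Y (G (i n))"
          using closedin_zero_sets[OF G_zero_sets[OF \<open>i n \<in> I\<close>]] .
        \<comment> \<open>Such a Z would meet \<open>G k\<close> at y while missing
          \<open>G (i n)\<close>, although \<open>F k\<close> is contained in
          \<open>F (i n)\<close>.\<close>
        ultimately obtain Z where Z: "Z \<in> zero_sets Y" "y \<in> Z" "Z \<inter> G (i n) = {}"
          using Y ytop i(2) completely_regular_separation[of Y "G (i n)" y]
          unfolding Hewitt_space_def by auto
        then obtain j where j: "j \<in> I" "G j = Z" using G_cover[OF Z(1,2)] by blast
        then show False
          using G_mono[OF k(1) \<open>i n \<in> I\<close> _ j(1)] k(2) i(2) j(2) Z(2,3) y by blast
      qed
    qed
    ultimately show "\<exists>Z\<in>G ` U. \<forall>n. Z \<subseteq> A n" by blast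
  qed
  obtain y where y: "y \<in> topspace Y" "\<And>i. i \<in> U \<Longrightarrow> y \<in> G i"
    using fixed Y unfolding Hewitt_space_def by blast
  have "i \<in> U" if "i \<in> I" "y \<in> G i" for i
  proof (rule in_U[OF that(1)])
    show "G i \<inter> G j \<noteq> {}" if "j \<in> U" for j
      using y(2)[OF that] \<open>y \<in> G i\<close> by blast
  qed
  then have "related x y" using x y by (auto simp: related_def U_def)
  then show ?thesis ..
qed

lemma related_unique:
  assumes "related x y" "related x y'"
  shows "y = y'"
proof (rule ccontr)
  assume ne: "y \<noteq> y'"
  have "closedin Y {y'}"
    using Y assms(2) Hausdorff_imp_t1_space[of Y]
    by (auto simp: Hewitt_space_def related_def t1_space_closedin_singleton)
  then obtain Z where Z: "Z \<in> zero_sets Y" "y \<in> Z" "Z \<inter> {y'} = {}"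
    using Y assms(1) ne completely_regular_separation[of Y "{y'}" y]
    unfolding Hewitt_space_def related_def by blast
  then obtain j where "j \<in> I" "G j = Z" using G_cover[OF Z(1,2)] by blast
  then show False using assms Z unfolding related_def by blast
qed

text \<open>A nonempty closed C is the intersection of the sets \<open>G i\<close> containing it, so
  its preimage is the intersection of the closed sets \<open>F i\<close> with the same
  indices.\<close>

lemma continuous_related:
  assumes t: "\<And>x. x \<in> topspace X \<Longrightarrow> related x (t x)"
  shows "continuous_map X Y t"
  unfolding continuous_map_closedin
proof (intro conjI allI impI funcsetI)
  show "t x \<in> topspace Y" if "x \<in> topspace X" for x
    using t[OF that] by (simp add: related_def)
  fix C assume C: "closedin Y C"
  define J where "J = {i \<in> I. C \<subseteq> G i}"
  have "{x \<in> topspace X. t x \<in> C} = topspace X \<inter> (\<Inter>i\<in>J. F i)" if ne: "C \<noteq> {}"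
  proof (intro equalityI subsetI)
    fix x assume "x \<in> {x \<in> topspace X. t x \<in> C}"
    then show "x \<in> topspace X \<inter> (\<Inter>i\<in>J. F i)"
      using t by (auto simp: J_def related_def)
  next
    fix x assume x: "x \<in> topspace X \<inter> (\<Inter>i\<in>J. F i)"
    have "t x \<in> C"
    proof (rule ccontr)
      assume "t x \<notin> C"
      then obtain Z where Z: "Z \<in> zero_sets Y" "C \<subseteq> Z" "t x \<notin> Z"
        using completely_regular_separation'[OF _ C, of "t x"] Y x t
        unfolding Hewitt_space_def related_def by blast
      \<comment> \<open>A point of C ensures that Z is nonempty and hence indexed; this is why the
        empty C is treated apart.\<close>
      moreover obtain c where "c \<in> C" using ne by blast
      ultimately obtain i where i: "i \<in> I" "G i = Z" using G_cover[of Z c] by blast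
      then show False using Z x t[of x] by (auto simp: J_def related_def)
    qed
    then show "x \<in> {x \<in> topspace X. t x \<in> C}" using x by blast
  qed
  moreover have "closedin X (topspace X \<inter> (\<Inter>i\<in>J. F i))"
  proof (cases "J = {}")
    case False
    have "closedin X (F i)" if "i \<in> J" for i
      using that by (auto simp: J_def intro: closedin_zero_sets F_zero_sets)
    then show ?thesis using False by (intro closedin_Int closedin_INT) auto
  qed simp
  ultimately show "closedin X {x \<in> topspace X. t x \<in> C}" by (cases "C = {}") auto
qed

end

text \<open>Exchanging the two families gives a matching from Y to X with the converse relation. The
  resulting continuous maps are mutually inverse, since related points are unique on each
  side.\<close>

lemma zero_set_matching_imp_homeomorphic:
  assumes "zero_set_matching X Y I F G"
  shows "X homeomorphic_space Y"
proof -
  interpret zero_set_matching X Y I F G by fact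
  interpret inv: zero_set_matching Y X I G F
    by unfold_locales (use X Y F G meet in auto)
  have conv: "inv.related y x \<longleftrightarrow> related x y" for x y
    by (auto simp: related_def inv.related_def)
  obtain t where t: "\<And>x. x \<in> topspace X \<Longrightarrow> related x (t x)"
    using related_exists by metis
  obtain s where s: "\<And>y. y \<in> topspace Y \<Longrightarrow> related (s y) y"
    using inv.related_exists conv by metis
  have "homeomorphic_maps X Y t s"
    unfolding homeomorphic_maps_def
  proof (intro conjI ballI)
    show "continuous_map X Y t" using t by (rule continuous_related)
    show "continuous_map Y X s" using s conv by (intro inv.continuous_related) blast
    show "s (t x) = x" if "x \<in> topspace X" for x
      using t[OF that] s[of "t x"] inv.related_unique conv unfolding related_def by blast
    show "t (s y) = y" if "y \<in> topspace Y" for y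
      using s[OF that] t[of "s y"] related_unique unfolding related_def by blast
  qed
  then show ?thesis by (rule homeomorphic_maps_imp_homeomorphic_space)
qed

text \<open>The vertex sets are left arbitrary, subject to supplying all nonempty zero sets, so that
  both kinds of graph are covered.\<close>

lemma graph_isomorphic_imp_homeomorphic:
  assumes "Hewitt_space X" "Hewitt_space Y"
    and V: "zero_set X ` V = zero_sets X - {{}}" and V': "zero_set Y ` V' = zero_sets Y - {{}}"
    and iso: "graph_isomorphic \<lparr>verts = V, adjacent = zero_set_adjacent X\<rparr>
                \<lparr>verts = V', adjacent = zero_set_adjacent Y\<rparr>"
  shows "X homeomorphic_space Y"
proof -
  obtain \<phi> where bij: "bij_betw \<phi> V V'"
    and adj: "\<And>f g. f \<in> V \<Longrightarrow> g \<in> V \<Longrightarrow>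
      zero_set_adjacent X f g \<longleftrightarrow> zero_set_adjacent Y (\<phi> f) (\<phi> g)"
    using iso by (auto simp: graph_isomorphic_def)
  have "zero_set_matching X Y V (zero_set X) (\<lambda>f. zero_set Y (\<phi> f))"
  proof
    show "(\<lambda>f. zero_set Y (\<phi> f)) ` V = zero_sets Y - {{}}"
      using V' bij_betw_imp_surj_on[OF bij] by (metis image_image)
    fix f g assume fg: "f \<in> V" "g \<in> V"
    show "zero_set X f \<inter> zero_set X g \<noteq> {} \<longleftrightarrow> zero_set Y (\<phi> f) \<inter> zero_set Y (\<phi> g) \<noteq> {}"
    proof (cases "f = g")
      \<comment> \<open>Adjacency is silent about a vertex paired with itself, but then both sides
        hold because zero sets of vertices are nonempty.\<close>
      case True
      have "zero_set X g \<in> zero_sets X - {{}}" using fg(2) V by blast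
      moreover have "zero_set Y (\<phi> g) \<in> zero_sets Y - {{}}"
        using fg(2) V' bij_betwE[OF bij] by blast
      ultimately show ?thesis using True by simp
    next
      case False
      then have "\<phi> f \<noteq> \<phi> g" using fg bij by (meson bij_betw_imp_inj_on inj_onD)
      then show ?thesis using adj[OF fg] False by (simp add: zero_set_adjacent_def)
    qed
  qed (use assms in auto)
  then show ?thesis by (rule zero_set_matching_imp_homeomorphic)
qed

section \<open>Isomorphisms of function semirings\<close>

text \<open>Being a unit is expressed by products equal to the identity, and a bijective
  homomorphism transports these equations both ways. Since only a monoid is assumed, semirings are
  included.\<close>

lemma ring_iso_Units_iff:
  assumes R: "monoid R" and h: "h \<in> ring_iso R S" and a: "a \<in> carrier R"
  shows "h a \<in> Units S \<longleftrightarrow> a \<in> Units R"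
proof -
  have mult: "h (x \<otimes>\<^bsub>R\<^esub> y) = h x \<otimes>\<^bsub>S\<^esub> h y" if "x \<in> carrier R" "y \<in> carrier R" for x y
    using h that by (simp add: ring_iso_memE)
  have one: "h \<one>\<^bsub>R\<^esub> = \<one>\<^bsub>S\<^esub>" using h by (rule ring_iso_memE)
  have bij: "bij_betw h (carrier R) (carrier S)" using h by (rule ring_iso_memE)
  have eq: "x \<otimes>\<^bsub>R\<^esub> y = \<one>\<^bsub>R\<^esub> \<longleftrightarrow> h x \<otimes>\<^bsub>S\<^esub> h y = \<one>\<^bsub>S\<^esub>" if "x \<in> carrier R" "y \<in> carrier R" for x y
    using that mult one bij monoid.m_closed[OF R that] monoid.one_closed[OF R]
    by (metis bij_betw_imp_inj_on inj_onD)
  have "carrier S = h ` carrier R" using bij by (simp add: bij_betw_imp_surj_on)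
  then show ?thesis using a by (simp add: Units_def eq)
qed

text \<open>A sum of non-negative functions vanishes exactly where both do, so adjacency is
  expressible in the semiring.\<close>

lemma zero_set_adjacent_plus_iff:
  assumes "f \<in> carrier (C_plus X)" "g \<in> carrier (C_plus X)"
  shows "zero_set_adjacent X f g \<longleftrightarrow> f \<noteq> g \<and> f \<oplus>\<^bsub>C_plus X\<^esub> g \<notin> Units (C_plus X)"
proof -
  let ?h = "f \<oplus>\<^bsub>C_plus X\<^esub> g"
  have h: "?h \<in> carrier (C_plus X)"
    using semiring_C_plus[of X] assms by (simp add: semiring_def abelian_monoid.a_closed)
  have "?h \<notin> Units (C_plus X) \<longleftrightarrow> ?h \<in> nonunits_plus X"
    using h by (simp add: nonunits_plus_eq)
  also have "\<dots> \<longleftrightarrow> zero_set X ?h \<noteq> {}"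
    using h by (simp add: nonunits_plus_def mem_nonunits_iff mem_carrier_C_plus)
  also have "zero_set X ?h = zero_set X f \<inter> zero_set X g"
    using assms
    by (auto simp: C_plus_simps zero_set_def mem_carrier_C_plus add_nonneg_eq_0_iff)
  finally show ?thesis by (simp add: zero_set_adjacent_def)
qed

text \<open>Squaring removes the possible cancellation in a sum of functions of arbitrary
  sign.\<close>

lemma zero_set_adjacent_ring_iff:
  assumes "f \<in> carrier (C_ring X)" "g \<in> carrier (C_ring X)"
  shows "zero_set_adjacent X f g \<longleftrightarrow> f \<noteq> g \<and>
    f \<otimes>\<^bsub>C_ring X\<^esub> f \<oplus>\<^bsub>C_ring X\<^esub> g \<otimes>\<^bsub>C_ring X\<^esub> g \<notin> Units (C_ring X)"
proof -
  let ?h = "f \<otimes>\<^bsub>C_ring X\<^esub> f \<oplus>\<^bsub>C_ring X\<^esub> g \<otimes>\<^bsub>C_ring X\<^esub> g"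
  interpret cring "C_ring X" by (rule cring_C_ring)
  have "?h \<in> carrier (C_ring X)" using assms by simp
  moreover have "zero_set X ?h = zero_set X f \<inter> zero_set X g"
    by (auto simp: C_ring_simps zero_set_def)
  ultimately have "?h \<notin> Units (C_ring X) \<longleftrightarrow> zero_set X f \<inter> zero_set X g \<noteq> {}"
    using mem_nonunits_iff[of ?h X] by (auto simp: nonunits_def)
  then show ?thesis by (simp add: zero_set_adjacent_def)
qed

lemma ring_iso_bij_betw_nonunits:
  assumes R: "monoid R" and h: "h \<in> ring_iso R S"
  shows "bij_betw h (carrier R - Units R) (carrier S - Units S)"
proof -
  have bij: "bij_betw h (carrier R) (carrier S)" using h by (rule ring_iso_memE)
  have "h ` (carrier R - Units R) = carrier S - Units S"
    unfolding bij_betw_imp_surj_on[OF bij, symmetric] using ring_iso_Units_iff[OF R h] by auto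
  then show ?thesis
    using bij by (auto simp: bij_betw_def inj_on_def)
qed

section \<open>Algebraic isomorphisms induce graph isomorphisms\<close>

lemma C_plus_iso_imp_graph_isomorphic:
  assumes "C_plus X \<simeq> C_plus Y"
  shows "graph_isomorphic (Gamma_C_plus X) (Gamma_C_plus Y)"
proof -
  obtain h where h: "h \<in> ring_iso (C_plus X) (C_plus Y)"
    using assms by (auto simp: is_ring_iso_def)
  interpret semiring "C_plus X" by (rule semiring_C_plus)
  have M: "monoid (C_plus X)" ..
  have "zero_set_adjacent X f g \<longleftrightarrow> zero_set_adjacent Y (h f) (h g)"
    if fg: "f \<in> carrier (C_plus X)" "g \<in> carrier (C_plus X)" for f g
  proof -
    have "h f = h g \<longleftrightarrow> f = g"
      using fg ring_iso_memE(5)[OF h] by (meson bij_betw_imp_inj_on inj_on_eq_iff)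
    moreover have "h f \<oplus>\<^bsub>C_plus Y\<^esub> h g \<in> Units (C_plus Y) \<longleftrightarrow>
        f \<oplus>\<^bsub>C_plus X\<^esub> g \<in> Units (C_plus X)"
      using ring_iso_Units_iff[OF M h, of "f \<oplus>\<^bsub>C_plus X\<^esub> g"] fg h
      by (simp add: ring_iso_memE)
    ultimately show ?thesis
      using fg ring_iso_memE(1)[OF h] by (simp add: zero_set_adjacent_plus_iff)
  qed
  then show ?thesis
    using ring_iso_bij_betw_nonunits[OF M h]
    unfolding graph_isomorphic_def Gamma_C_plus_def nonunits_plus_eq
    by (intro exI[of _ h]) simp
qed

lemma C_ring_iso_imp_graph_isomorphic:
  assumes "C_ring X \<simeq> C_ring Y"
  shows "graph_isomorphic (Gamma_C X) (Gamma_C Y)"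
proof -
  obtain h where h: "h \<in> ring_iso (C_ring X) (C_ring Y)"
    using assms by (auto simp: is_ring_iso_def)
  interpret cring "C_ring X" by (rule cring_C_ring)
  have M: "monoid (C_ring X)" ..
  have "zero_set_adjacent X f g \<longleftrightarrow> zero_set_adjacent Y (h f) (h g)"
    if fg: "f \<in> carrier (C_ring X)" "g \<in> carrier (C_ring X)" for f g
  proof -
    have "h f = h g \<longleftrightarrow> f = g"
      using fg ring_iso_memE(5)[OF h] by (meson bij_betw_imp_inj_on inj_on_eq_iff)
    moreover have "h f \<otimes>\<^bsub>C_ring Y\<^esub> h f \<oplus>\<^bsub>C_ring Y\<^esub> h g \<otimes>\<^bsub>C_ring Y\<^esub> h g \<in> Units (C_ring Y) \<longleftrightarrow>
        f \<otimes>\<^bsub>C_ring X\<^esub> f \<oplus>\<^bsub>C_ring X\<^esub> g \<otimes>\<^bsub>C_ring X\<^esub> g \<in> Units (C_ring X)"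
      using ring_iso_Units_iff[OF M h, of "f \<otimes>\<^bsub>C_ring X\<^esub> f \<oplus>\<^bsub>C_ring X\<^esub> g \<otimes>\<^bsub>C_ring X\<^esub> g"] fg h
      by (simp add: ring_iso_memE)
    ultimately show ?thesis
      using fg ring_iso_memE(1)[OF h] by (simp add: zero_set_adjacent_ring_iff)
  qed
  then show ?thesis
    using ring_iso_bij_betw_nonunits[OF M h]
    unfolding graph_isomorphic_def Gamma_C_def nonunits_def
    by (intro exI[of _ h]) simp
qed

section \<open>Homeomorphisms induce algebraic isomorphisms\<close>

lemma homeomorphic_imp_function_rings_iso:
  assumes "X homeomorphic_space Y"
  shows "C_ring X \<simeq> C_ring Y" and "C_plus X \<simeq> C_plus Y"
proof -
  obtain t s where t: "continuous_map X Y t" and s: "continuous_map Y X s"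
    and st: "\<And>x. x \<in> topspace X \<Longrightarrow> s (t x) = x" and ts: "\<And>y. y \<in> topspace Y \<Longrightarrow> t (s y) = y"
    using assms by (auto simp: homeomorphic_space_def homeomorphic_maps_def)
  have t_top: "\<And>x. x \<in> topspace X \<Longrightarrow> t x \<in> topspace Y"
    and s_top: "\<And>y. y \<in> topspace Y \<Longrightarrow> s y \<in> topspace X"
    using continuous_map_funspace[OF t] continuous_map_funspace[OF s] by auto
  \<comment> \<open>Composition is contravariant, so the map from functions on X to functions on Y
    uses the inverse s. It preserves non-negativity, so the same h serves ring and semiring.\<close>
  define h :: "('a \<Rightarrow> real) \<Rightarrow> 'b \<Rightarrow> real" where "h f = (\<lambda>y\<in>topspace Y. f (s y))" for f
  define k :: "('b \<Rightarrow> real) \<Rightarrow> 'a \<Rightarrow> real" where "k f = (\<lambda>x\<in>topspace X. f (t x))" for f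
  have h_mem: "h f \<in> carrier (C_ring Y)" if "f \<in> carrier (C_ring X)" for f
    unfolding h_def using that continuous_map_compose[OF s, of euclideanreal f]
    by (intro restrict_in_carrier_C_ring) (simp add: mem_carrier_C_ring o_def)
  have k_mem: "k f \<in> carrier (C_ring X)" if "f \<in> carrier (C_ring Y)" for f
    unfolding k_def using that continuous_map_compose[OF t, of euclideanreal f]
    by (intro restrict_in_carrier_C_ring) (simp add: mem_carrier_C_ring o_def)
  have kh: "k (h f) = f" if "f \<in> carrier (C_ring X)" for f
    using that t_top st
    by (auto simp: h_def k_def mem_carrier_C_ring extensional_def fun_eq_iff)
  have hk: "h (k f) = f" if "f \<in> carrier (C_ring Y)" for f
    using that s_top ts
    by (auto simp: h_def k_def mem_carrier_C_ring extensional_def fun_eq_iff)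
  have bij: "bij_betw h (carrier (C_ring X)) (carrier (C_ring Y))"
    using h_mem k_mem kh hk by (intro bij_betwI[where g = k]) auto
  have h_plus: "h f \<in> carrier (C_plus Y)" if "f \<in> carrier (C_plus X)" for f
    using that h_mem s_top by (simp add: mem_carrier_C_plus) (simp add: h_def)
  have k_plus: "k f \<in> carrier (C_plus X)" if "f \<in> carrier (C_plus Y)" for f
    using that k_mem t_top by (simp add: mem_carrier_C_plus) (simp add: k_def)
  have bij_plus: "bij_betw h (carrier (C_plus X)) (carrier (C_plus Y))"
    using h_plus k_plus kh hk by (intro bij_betwI[where g = k]) (auto simp: mem_carrier_C_plus)
  have "h \<in> ring_iso (C_ring X) (C_ring Y)"
    using h_mem bij s_top
    by (intro ring_iso_memI) (auto simp: C_ring_simps, auto simp: h_def)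
  then show "C_ring X \<simeq> C_ring Y" by (auto simp: is_ring_iso_def)
  have "h \<in> ring_iso (C_plus X) (C_plus Y)"
    using h_plus bij_plus s_top
    by (intro ring_iso_memI) (auto simp: C_plus_simps, auto simp: h_def)
  then show "C_plus X \<simeq> C_plus Y" by (auto simp: is_ring_iso_def)
qed

theorem theorem4p11:
  fixes X :: "'a topology" and Y :: "'b topology"
  assumes "Hewitt_space X" and "Hewitt_space Y"
  shows "(X homeomorphic_space Y \<longleftrightarrow> C_plus X \<simeq> C_plus Y) \<and>
         (C_plus X \<simeq> C_plus Y \<longleftrightarrow> graph_isomorphic (Gamma_C_plus X) (Gamma_C_plus Y)) \<and>
         (graph_isomorphic (Gamma_C_plus X) (Gamma_C_plus Y) \<longleftrightarrow>
            graph_isomorphic (Gamma_C X) (Gamma_C Y)) \<and>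
         (graph_isomorphic (Gamma_C X) (Gamma_C Y) \<longleftrightarrow> C_ring X \<simeq> C_ring Y)"
proof -
  have "X homeomorphic_space Y" if "graph_isomorphic (Gamma_C_plus X) (Gamma_C_plus Y)"
    using graph_isomorphic_imp_homeomorphic[OF assms zero_set_nonunits_plus zero_set_nonunits_plus]
      that unfolding Gamma_C_plus_def .
  moreover have "X homeomorphic_space Y" if "graph_isomorphic (Gamma_C X) (Gamma_C Y)"
    using graph_isomorphic_imp_homeomorphic[OF assms zero_set_nonunits zero_set_nonunits]
      that unfolding Gamma_C_def .
  \<comment> \<open>Two cycles through homeomorphism close the equivalence, one along the semirings
    and their graphs, the other along the rings and theirs.\<close>
  ultimately show ?thesis
    using homeomorphic_imp_function_rings_iso[of X Y] C_plus_iso_imp_graph_isomorphic[of X Y]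
      C_ring_iso_imp_graph_isomorphic[of X Y]
    by blast
qed

end
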